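(* Let $A,C,\sigma,R_a$ be positive real numbers and consider the system $$\dot x=Ayz+Cz-\sigma x,\qquad \dot y=-xz+R_a-y,\qquad \dot z=-z+xy$$ on $\mathbb{R}^3$. The flow of its Poincaré compactification on the sphere at infinity has four centers, localized at the endpoints of the $x$-axis and of the $z$-axis, and two saddles, localized at the endpoints of the $y$-axis.
   Context: Poincaré compactification: let $S^3=\{r\in\mathbb{R}^4:\|r\|=1\}$; $\mathbb{R}^3$ is identified with the open hemisphere $r_4>0$ by central projection $(x,y,z)\mapsto (x,y,z,1)/\sqrt{1+x^2+y^2+z^2}$, and the sphere at infinity is the equator $\{r\in S^3:r_4=0\}\cong S^2$. After a rescaling of time the polynomial vector field extends to the closed hemisphere and leaves the sphere at infinity invariant. In the local charts $U_i=\{r_i>0\}$, $i=1,2,3$, with coordinates $(z_1,z_2,z_3)$, the extension is obtained by the change of variables $(x,y,z)=(z_3^{-1},z_1z_3^{-1},z_2z_3^{-1})$ for $U_1$, $(x,y,z)=(z_1z_3^{-1},z_3^{-1},z_2z_3^{-1})$ for $U_2$, $(x,y,z)=(z_1z_3^{-1},z_2z_3^{-1},z_3^{-1})$ for $U_3$, together with the time rescaling $d\tau=z_3^{-1}dt$; the sphere at infinity is $\{z_3=0\}$, and the flow at infinity is the planar flow in $(z_1,z_2)$ obtained by setting $z_3=0$. In the charts $V_i=\{r_i<0\}$ the flow at infinity is given by the same expressions as in $U_i$ with time reversed. The endpoints of the $x$-, $y$-, $z$-axis are the origins of the charts $U_1,V_1$; $U_2,V_2$; $U_3,V_3$, respectively.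 A center is an equilibrium of the two-dimensional flow at infinity having a punctured neighbourhood filled with periodic orbits; a saddle is an equilibrium of this flow whose linearization has one positive and one negative eigenvalue. *)

theory Defs
  imports "HOL-Analysis.Analysis"
begin

section \<open>Poincare compactification of a quadratic vector field on R^3\<close>

lemma vector_4 [simp]:
  "(vector [a, b, c, d] :: 'a::zero ^ 4) $ 1 = a"
  "(vector [a, b, c, d] :: 'a::zero ^ 4) $ 2 = b"
  "(vector [a, b, c, d] :: 'a::zero ^ 4) $ 3 = c"
  "(vector [a, b, c, d] :: 'a::zero ^ 4) $ 4 = d"
  unfolding vector_def by simp_all

definition central_proj :: "real^3 \<Rightarrow> real^4" where
  "central_proj p = (1 / sqrt (1 + (p$1)\<^sup>2 + (p$2)\<^sup>2 + (p$3)\<^sup>2)) *\<^sub>R vector [p$1, p$2, p$3, 1]"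

definition sphere_at_infinity :: "(real^4) set" where
  "sphere_at_infinity = {r. norm r = 1 \<and> r$4 = 0}"

text \<open>
  Charts are indexed by \<open>i \<in> {1, 2, 3}\<close>; in the definitions by cases below the last branch
  stands for \<open>i = 3\<close>. The coordinates of \<open>r\<close> are the same in \<open>U\<^sub>i\<close> (where \<open>r$i > 0\<close>) and in
  \<open>V\<^sub>i\<close> (where \<open>r$i < 0\<close>).
\<close>

definition chart_coord :: "4 \<Rightarrow> real^4 \<Rightarrow> real^3" where
  "chart_coord i r =
    (if i = 1 then vector [r$2 / r$1, r$3 / r$1, r$4 / r$1]
     else if i = 2 then vector [r$1 / r$2, r$3 / r$2, r$4 / r$2]
     else vector [r$1 / r$3, r$2 / r$3, r$4 / r$3])"

definition chart_subst :: "4 \<Rightarrow> real^3 \<Rightarrow> real^3" where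
  "chart_subst i z =
    (if i = 1 then vector [1 / z$3, z$1 / z$3, z$2 / z$3]
     else if i = 2 then vector [z$1 / z$3, 1 / z$3, z$2 / z$3]
     else vector [z$1 / z$3, z$2 / z$3, 1 / z$3])"

lemma chart_coord_central_proj_chart_subst:
  assumes "z$3 \<noteq> 0"
  shows "chart_coord i (central_proj (chart_subst i z)) = z"
proof -
  have "1 + a\<^sup>2 + b\<^sup>2 + c\<^sup>2 > 0" for a b c :: real
    by (smt (verit) zero_le_power2)
  then have "sqrt (1 + a\<^sup>2 + b\<^sup>2 + c\<^sup>2) \<noteq> 0" for a b c :: real
    by (metis less_irrefl real_sqrt_gt_zero)
  then show ?thesis
    using assms by (simp add: chart_coord_def central_proj_def chart_subst_def vec_eq_iff forall_3)
qed

text \<open>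
  The vector field \<open>F\<close> transported to the coordinates \<open>(z1, z2, z3)\<close> of \<open>U\<^sub>i\<close> (chain rule), in the
  new time: \<open>d\<tau> = z3\<^sup>-\<^sup>1 dt\<close> means \<open>dz/d\<tau> = z3 dz/dt\<close>. This power of \<open>z3\<close> is the one
  appropriate for fields of degree two.
\<close>

definition chart_field :: "4 \<Rightarrow> (real^3 \<Rightarrow> real^3) \<Rightarrow> real^3 \<Rightarrow> real^3" where
  "chart_field i F z =
    z$3 *\<^sub>R frechet_derivative (\<lambda>p. chart_coord i (central_proj p)) (at (chart_subst i z))
             (F (chart_subst i z))"

text \<open>The continuous extension to the closed half space \<open>z3 \<ge> 0\<close>.\<close>

definition chart_field_ext :: "4 \<Rightarrow> (real^3 \<Rightarrow> real^3) \<Rightarrow> real^3 \<Rightarrow> real^3" where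
  "chart_field_ext i F z =
    (if z$3 > 0 then chart_field i F z
     else Lim (at z within {w. w$3 > 0}) (chart_field i F))"

definition field_at_infinity :: "4 \<Rightarrow> (real^3 \<Rightarrow> real^3) \<Rightarrow> real^2 \<Rightarrow> real^2" where
  "field_at_infinity i F u =
    (let w = chart_field_ext i F (vector [u$1, u$2, 0]) in vector [w$1, w$2])"

section \<open>Centers and saddles\<close>

definition is_solution :: "(real^2 \<Rightarrow> real^2) \<Rightarrow> (real \<Rightarrow> real^2) \<Rightarrow> bool" where
  "is_solution g \<gamma> \<longleftrightarrow> (\<forall>t. (\<gamma> has_vector_derivative g (\<gamma> t)) (at t))"

definition is_periodic_orbit :: "(real^2 \<Rightarrow> real^2) \<Rightarrow> (real^2) set \<Rightarrow> bool" where
  "is_periodic_orbit g X \<longleftrightarrow>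
    (\<exists>\<gamma> T. is_solution g \<gamma> \<and> T > 0 \<and> (\<forall>t. \<gamma> (t + T) = \<gamma> t) \<and>
           (\<exists>t. \<gamma> t \<noteq> \<gamma> 0) \<and> X = range \<gamma>)"

definition is_center :: "(real^2 \<Rightarrow> real^2) \<Rightarrow> real^2 \<Rightarrow> bool" where
  "is_center g p \<longleftrightarrow>
    g p = 0 \<and>
    (\<exists>N. open N \<and> p \<in> N \<and>
         (\<forall>q \<in> N - {p}. \<exists>X. is_periodic_orbit g X \<and> q \<in> X \<and> X \<subseteq> N - {p}))"

definition is_saddle :: "(real^2 \<Rightarrow> real^2) \<Rightarrow> real^2 \<Rightarrow> bool" where
  "is_saddle g p \<longleftrightarrow>
    g p = 0 \<and>
    (\<exists>L. (g has_derivative L) (at p) \<and>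
         (\<exists>l v. l > 0 \<and> v \<noteq> 0 \<and> L v = l *\<^sub>R v) \<and>
         (\<exists>m v. m < 0 \<and> v \<noteq> 0 \<and> L v = m *\<^sub>R v))"

text \<open>
  A property of planar equilibria, read at a point \<open>r\<close> of the sphere at infinity in some chart
  containing \<open>r\<close>. The sign \<open>s\<close> selects \<open>U\<^sub>i\<close> (\<open>s = 1\<close>) or \<open>V\<^sub>i\<close> (\<open>s = -1\<close>, time reversed).
  Being a center or a saddle does not depend on the chart, since on overlaps the flows
  differ by a diffeomorphism and a positive change of time.
\<close>

definition at_infinity_in_chart ::
  "((real^2 \<Rightarrow> real^2) \<Rightarrow> real^2 \<Rightarrow> bool) \<Rightarrow> (real^3 \<Rightarrow> real^3) \<Rightarrow> real^4 \<Rightarrow> bool" where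
  "at_infinity_in_chart P F r \<longleftrightarrow>
    r \<in> sphere_at_infinity \<and>
    (\<exists>i \<in> {1, 2, 3}. \<exists>s \<in> {1, -1}. s * r$i > 0 \<and>
       P (\<lambda>u. s *\<^sub>R field_at_infinity i F u) (vector [chart_coord i r $ 1, chart_coord i r $ 2]))"

definition centers_at_infinity :: "(real^3 \<Rightarrow> real^3) \<Rightarrow> (real^4) set" where
  "centers_at_infinity F = {r. at_infinity_in_chart is_center F r}"

definition saddles_at_infinity :: "(real^3 \<Rightarrow> real^3) \<Rightarrow> (real^4) set" where
  "saddles_at_infinity F = {r. at_infinity_in_chart is_saddle F r}"

text \<open>Endpoints of the \<open>k\<close>-th coordinate axis, i.e. the origins of \<open>U\<^sub>k\<close> and \<open>V\<^sub>k\<close>.\<close>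

definition axis_endpoints :: "4 \<Rightarrow> (real^4) set" where
  "axis_endpoints k = {axis k 1, - axis k 1}"

section \<open>The system\<close>

definition system_field :: "real \<Rightarrow> real \<Rightarrow> real \<Rightarrow> real \<Rightarrow> real^3 \<Rightarrow> real^3" where
  "system_field A C \<sigma> Ra p =
    (let x = p$1; y = p$2; z = p$3 in
     vector [A * y * z + C * z - \<sigma> * x, - x * z + Ra - y, - z + x * y])"

end

theory Submission
  imports Defs
begin

text \<open>
  The flow at infinity sees only the quadratic part \<open>(A y z, - x z, x y)\<close>. In \<open>U\<^sub>1\<close> and \<open>U\<^sub>3\<close> it has,
  up to time reversal, the form \<open>u' = - v (a + b u\<^sup>2)\<close>, \<open>v' = u (d - b v\<^sup>2)\<close> with \<open>a, d > 0\<close>.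
  After scaling \<open>u\<close> and \<open>v\<close> by \<open>sqrt a\<close> and \<open>sqrt d\<close>, the angular speed is the constant
  \<open>sqrt (a d)\<close> and the inverse square of the radius equals \<open>c + b sin\<^sup>2\<close> of the angle, so the orbits
  near the origin are explicit and periodic. In \<open>U\<^sub>2\<close> the product \<open>u v\<close> of the coordinates strictly increases
  along every orbit but the origin, which excludes periodic orbits.
\<close>

section \<open>The field in the charts at infinity\<close>

lemma vec2_has_derivative [derivative_intros]:
  fixes f g :: "'a::real_normed_vector \<Rightarrow> real"
  assumes "(f has_derivative f') F" and "(g has_derivative g') F"
  shows "((\<lambda>x. vector [f x, g x] :: real^2) has_derivative (\<lambda>h. vector [f' h, g' h])) F"
proof -
  have eq: "(vector [a, b] :: real^2) = a *\<^sub>R axis 1 1 + b *\<^sub>R axis 2 1" for a b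
    by (simp add: vec_eq_iff forall_2 axis_def)
  show ?thesis
    unfolding eq by (intro derivative_intros assms)
qed

lemma vector_3_eq_axis:
  "(vector [a, b, c] :: real^3) = a *\<^sub>R axis 1 1 + b *\<^sub>R axis 2 1 + c *\<^sub>R axis 3 1"
  by (simp add: vec_eq_iff forall_3 axis_def)

lemma vec3_has_derivative [derivative_intros]:
  fixes f g k :: "'a::real_normed_vector \<Rightarrow> real"
  assumes "(f has_derivative f') F" and "(g has_derivative g') F" and "(k has_derivative k') F"
  shows "((\<lambda>x. vector [f x, g x, k x] :: real^3) has_derivative
           (\<lambda>h. vector [f' h, g' h, k' h])) F"
  unfolding vector_3_eq_axis by (intro derivative_intros assms)

lemma norm_axis_real: "norm (axis k x :: real^'n) = \<bar>x\<bar>"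
proof -
  have "axis k x = x *\<^sub>R (axis k 1 :: real^'n)"
    by (simp add: vec_eq_iff axis_def)
  then show ?thesis
    by simp
qed

lemma vec_nth_has_derivative:
  "((\<lambda>p :: real^'n. p $ i) has_derivative (\<lambda>h. h $ i)) F"
  by (intro bounded_linear_imp_has_derivative bounded_linear_vec_nth)

lemma continuous_on_vec3 [continuous_intros]:
  fixes f g k :: "'a::topological_space \<Rightarrow> real"
  assumes "continuous_on S f" and "continuous_on S g" and "continuous_on S k"
  shows "continuous_on S (\<lambda>x. vector [f x, g x, k x] :: real^3)"
  unfolding vector_3_eq_axis by (intro continuous_intros assms)

text \<open>The normalising root cancels in the ratios, so the chart map is rational and its
  derivative comes from the quotient rule.\<close>

lemma chart_coord_central_proj:
  "chart_coord i (central_proj p) =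
    (if i = 1 then vector [p$2 / p$1, p$3 / p$1, 1 / p$1]
     else if i = 2 then vector [p$1 / p$2, p$3 / p$2, 1 / p$2]
     else vector [p$1 / p$3, p$2 / p$3, 1 / p$3])"
proof -
  have "1 + (p$1)\<^sup>2 + (p$2)\<^sup>2 + (p$3)\<^sup>2 > 0"
    by (smt (verit) zero_le_power2)
  then have "sqrt (1 + (p$1)\<^sup>2 + (p$2)\<^sup>2 + (p$3)\<^sup>2) \<noteq> 0"
    by (metis less_irrefl real_sqrt_gt_zero)
  then show ?thesis
    by (simp add: chart_coord_def central_proj_def vec_eq_iff forall_3)
qed

lemma quotient_coords_has_derivative:
  fixes p :: "real^3"
  assumes "p$k \<noteq> 0"
  shows "((\<lambda>p. vector [p$i / p$k, p$j / p$k, 1 / p$k] :: real^3) has_derivative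
     (\<lambda>h. vector [h$i / p$k - p$i * h$k / (p$k)\<^sup>2, h$j / p$k - p$j * h$k / (p$k)\<^sup>2,
                  - h$k / (p$k)\<^sup>2])) (at p)"
  by (rule has_derivative_eq_rhs, (rule derivative_intros vec_nth_has_derivative assms)+)
     (use assms in \<open>simp_all add: fun_eq_iff vec_eq_iff forall_3 divide_simps power2_eq_square\<close>)

text \<open>At the substituted point the first coordinate is \<open>1 / z$3\<close>, so the quotient
  rule yields a factor \<open>z$3\<close> and the new time another one. Their product clears the
  denominators of a quadratic \<open>F\<close>, leaving polynomials that make sense at
  \<open>z$3 = 0\<close>. Charts 2 and 3 work alike.\<close>

lemma chart_field_1:
  assumes "z$3 > 0"
  shows "chart_field 1 F z =
    (let w = (z$3)\<^sup>2 *\<^sub>R F (chart_subst 1 z)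
     in vector [w$2 - z$1 * w$1, w$3 - z$2 * w$1, - z$3 * w$1])"
proof -
  have "chart_subst 1 z $ 1 \<noteq> 0"
    using assms by (simp add: chart_subst_def)
  from frechet_derivative_at[OF quotient_coords_has_derivative[OF this, of 2 3], symmetric] show ?thesis
    using assms
    by (simp add: chart_field_def chart_coord_central_proj)
       (simp add: chart_subst_def vec_eq_iff forall_3 field_simps power2_eq_square)
qed

lemma chart_field_2:
  assumes "z$3 > 0"
  shows "chart_field 2 F z =
    (let w = (z$3)\<^sup>2 *\<^sub>R F (chart_subst 2 z)
     in vector [w$1 - z$1 * w$2, w$3 - z$2 * w$2, - z$3 * w$2])"
proof -
  have "chart_subst 2 z $ 2 \<noteq> 0"
    using assms by (simp add: chart_subst_def)
  from frechet_derivative_at[OF quotient_coords_has_derivative[OF this, of 1 3], symmetric] show ?thesis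
    using assms
    by (simp add: chart_field_def chart_coord_central_proj)
       (simp add: chart_subst_def vec_eq_iff forall_3 field_simps power2_eq_square)
qed

lemma chart_field_3:
  assumes "z$3 > 0"
  shows "chart_field 3 F z =
    (let w = (z$3)\<^sup>2 *\<^sub>R F (chart_subst 3 z)
     in vector [w$1 - z$1 * w$3, w$2 - z$2 * w$3, - z$3 * w$3])"
proof -
  have "chart_subst 3 z $ 3 \<noteq> 0"
    using assms by (simp add: chart_subst_def)
  from frechet_derivative_at[OF quotient_coords_has_derivative[OF this, of 1 2], symmetric] show ?thesis
    using assms
    by (simp add: chart_field_def chart_coord_central_proj)
       (simp add: chart_subst_def vec_eq_iff forall_3 field_simps power2_eq_square)
qed

text \<open>The value on \<open>z$3 = 0\<close> is a limit from the open half space; a continuous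
  formula valid there turns this limit into a substitution.\<close>

lemma field_at_infinity_eqI:
  assumes eq: "\<And>z. z$3 > 0 \<Longrightarrow> chart_field i F z = G z"
    and cont: "continuous_on UNIV G"
  shows "field_at_infinity i F u =
    (let w = G (vector [u$1, u$2, 0]) in vector [w$1, w$2])"
proof -
  let ?z = "vector [u$1, u$2, 0] :: real^3"
  let ?H = "{w :: real^3. w$3 > 0}"
  \<comment> \<open>\<open>Lim\<close> is determined only if the filter is nontrivial; the point is
    approached along the third axis.\<close>
  have "?z islimpt ?H"
    unfolding islimpt_approachable
  proof (intro allI impI)
    fix e :: real assume "e > 0"
    let ?w = "?z + axis 3 (e / 2)"
    have "dist ?w ?z < e"
      using \<open>e > 0\<close> by (simp add: dist_norm norm_axis_real)
    moreover have "?w $ 3 > 0"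
      using \<open>e > 0\<close> by simp
    moreover have "?w \<noteq> ?z"
      using \<open>e > 0\<close> by (auto simp: axis_eq_0_iff)
    ultimately show "\<exists>w\<in>?H. w \<noteq> ?z \<and> dist w ?z < e"
      by blast
  qed
  then have nontriv: "at ?z within ?H \<noteq> bot"
    by (simp add: trivial_limit_within)
  have "(G \<longlongrightarrow> G ?z) (at ?z within ?H)"
    using cont by (metis UNIV_I continuous_on_def subset_UNIV tendsto_within_subset)
  then have "(chart_field i F \<longlongrightarrow> G ?z) (at ?z within ?H)"
    by (rule Lim_transform_eventually) (auto simp: eventually_at_filter eq)
  from tendsto_Lim[OF nontriv this] show ?thesis
    by (simp add: field_at_infinity_def chart_field_ext_def)
qed

section \<open>The three planar fields at infinity\<close>

lemma system_at_infinity_1: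
  "field_at_infinity 1 (system_field A C \<sigma> Ra) =
    (\<lambda>u. vector [- u$2 * (1 + A * (u$1)\<^sup>2), u$1 * (1 - A * (u$2)\<^sup>2)])"
proof
  fix u
  \<comment> \<open>\<open>?P\<close>, \<open>?Q\<close>, \<open>?R\<close> are the components of
    the system at the substituted point, multiplied by \<open>(z$3)^2\<close>.\<close>
  let ?P = "\<lambda>z :: real^3. A * z$1 * z$2 + C * z$2 * z$3 - \<sigma> * z$3"
  let ?Q = "\<lambda>z :: real^3. - z$2 + Ra * (z$3)\<^sup>2 - z$1 * z$3"
  let ?R = "\<lambda>z :: real^3. - z$2 * z$3 + z$1"
  let ?G = "\<lambda>z. vector [?Q z - z$1 * ?P z, ?R z - z$2 * ?P z, - z$3 * ?P z] :: real^3"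
  have "chart_field 1 (system_field A C \<sigma> Ra) z = ?G z" if "z$3 > 0" for z
    using that
    by (simp add: chart_field_1 system_field_def chart_subst_def vec_eq_iff forall_3)
       (simp add: field_simps power2_eq_square)
  moreover have "continuous_on UNIV ?G"
    by (intro continuous_intros)
  ultimately show "field_at_infinity 1 (system_field A C \<sigma> Ra) u =
      vector [- u$2 * (1 + A * (u$1)\<^sup>2), u$1 * (1 - A * (u$2)\<^sup>2)]"
    by (subst field_at_infinity_eqI[where G = ?G])
       (auto simp: vec_eq_iff forall_2 algebra_simps power2_eq_square)
qed

lemma system_at_infinity_2:
  "field_at_infinity 2 (system_field A C \<sigma> Ra) =
    (\<lambda>u. vector [u$2 * (A + (u$1)\<^sup>2), u$1 * (1 + (u$2)\<^sup>2)])"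
proof
  fix u
  let ?P = "\<lambda>z :: real^3. A * z$2 + C * z$2 * z$3 - \<sigma> * z$1 * z$3"
  let ?Q = "\<lambda>z :: real^3. - z$1 * z$2 + Ra * (z$3)\<^sup>2 - z$3"
  let ?R = "\<lambda>z :: real^3. - z$2 * z$3 + z$1"
  let ?G = "\<lambda>z. vector [?P z - z$1 * ?Q z, ?R z - z$2 * ?Q z, - z$3 * ?Q z] :: real^3"
  have "chart_field 2 (system_field A C \<sigma> Ra) z = ?G z" if "z$3 > 0" for z
    using that
    by (simp add: chart_field_2 system_field_def chart_subst_def vec_eq_iff forall_3)
       (simp add: field_simps power2_eq_square)
  moreover have "continuous_on UNIV ?G"
    by (intro continuous_intros)
  ultimately show "field_at_infinity 2 (system_field A C \<sigma> Ra) u =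
      vector [u$2 * (A + (u$1)\<^sup>2), u$1 * (1 + (u$2)\<^sup>2)]"
    by (subst field_at_infinity_eqI[where G = ?G])
       (auto simp: vec_eq_iff forall_2 algebra_simps power2_eq_square)
qed

lemma system_at_infinity_3:
  "field_at_infinity 3 (system_field A C \<sigma> Ra) =
    (\<lambda>u. vector [u$2 * (A - (u$1)\<^sup>2), - u$1 * (1 + (u$2)\<^sup>2)])"
proof
  fix u
  let ?P = "\<lambda>z :: real^3. A * z$2 + C * z$3 - \<sigma> * z$1 * z$3"
  let ?Q = "\<lambda>z :: real^3. - z$1 + Ra * (z$3)\<^sup>2 - z$2 * z$3"
  let ?R = "\<lambda>z :: real^3. - z$3 + z$1 * z$2"
  let ?G = "\<lambda>z. vector [?P z - z$1 * ?R z, ?Q z - z$2 * ?R z, - z$3 * ?R z] :: real^3"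
  have "chart_field 3 (system_field A C \<sigma> Ra) z = ?G z" if "z$3 > 0" for z
    using that
    by (simp add: chart_field_3 system_field_def chart_subst_def vec_eq_iff forall_3)
       (simp add: field_simps power2_eq_square)
  moreover have "continuous_on UNIV ?G"
    by (intro continuous_intros)
  ultimately show "field_at_infinity 3 (system_field A C \<sigma> Ra) u =
      vector [u$2 * (A - (u$1)\<^sup>2), - u$1 * (1 + (u$2)\<^sup>2)]"
    by (subst field_at_infinity_eqI[where G = ?G])
       (auto simp: vec_eq_iff forall_2 algebra_simps power2_eq_square)
qed

section \<open>The rotating planar fields\<close>

text \<open>Parameters \<open>1 A 1\<close> give the field of \<open>U_1\<close>, and
  \<open>A (-1) 1\<close> the negative of that of \<open>U_3\<close>.\<close>

definition rot_field :: "real \<Rightarrow> real \<Rightarrow> real \<Rightarrow> real^2 \<Rightarrow> real^2" where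
  "rot_field a b d u = vector [- u$2 * (a + b * (u$1)\<^sup>2), u$1 * (d - b * (u$2)\<^sup>2)]"

text \<open>In the scaled coordinates \<open>p = u$1 / sqrt a\<close>,
  \<open>q = u$2 / sqrt d\<close>, the label \<open>c\<close> is the value on the orbit of the first
  integral \<open>(1 - b * q^2) / (p^2 + q^2)\<close>.\<close>

definition rot_orbit :: "real \<Rightarrow> real \<Rightarrow> real \<Rightarrow> real \<Rightarrow> real \<Rightarrow> real^2" where
  "rot_orbit a b d c \<theta> = (1 / sqrt (c + b * (sin \<theta>)\<^sup>2)) *\<^sub>R vector [sqrt a * cos \<theta>, sqrt d * sin \<theta>]"

text \<open>The expression is the convex combination of \<open>c\<close> and \<open>c + b\<close>
  with weights \<open>cos^2\<close> and \<open>sin^2\<close>.\<close>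

lemma rot_radius_pos:
  fixes b c \<theta> :: real
  assumes "c > 0" and "c + b > 0"
  shows "c + b * (sin \<theta>)\<^sup>2 > 0"
proof -
  have "c + b * (sin \<theta>)\<^sup>2 = c * (cos \<theta>)\<^sup>2 + (c + b) * (sin \<theta>)\<^sup>2"
    unfolding cos_squared_eq by (simp add: algebra_simps)
  moreover have "(cos \<theta>)\<^sup>2 > 0 \<or> (sin \<theta>)\<^sup>2 > 0"
    by (metis sin_zero_norm_cos_one norm_zero zero_less_power2 zero_neq_one)
  ultimately show ?thesis
    using assms by (smt (verit) mult_pos_pos mult_nonneg_nonneg zero_le_power2)
qed

lemma rot_orbit_has_vector_derivative:
  assumes "a > 0" and "d > 0" and "c > 0" and "c + b > 0"
  shows "((\<lambda>t. rot_orbit a b d c (s * sqrt (a * d) * t)) has_vector_derivative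
     s *\<^sub>R rot_field a b d (rot_orbit a b d c (s * sqrt (a * d) * t))) (at t)"
proof -
  define p q where "p = sqrt a" and "q = sqrt d"
  have ad: "a = p\<^sup>2" "d = q\<^sup>2"
    using assms by (simp_all add: p_def q_def)
  define w where "w = s * p * q"
  define D where "D t = c + b * (sin (w * t))\<^sup>2" for t
  define S where "S t = sqrt (D t)" for t
  have D: "D t > 0" for t
    unfolding D_def by (rule rot_radius_pos) fact+
  then have S: "S t > 0" for t
    by (simp add: S_def)
  have "(D has_real_derivative 2 * b * w * sin (w * t) * cos (w * t)) (at t)"
    unfolding D_def by (rule derivative_eq_intros refl)+ simp
  from DERIV_chain2[OF DERIV_real_sqrt[OF D] this]
  have has_S: "(S has_real_derivative b * w * sin (w * t) * cos (w * t) / S t) (at t)"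
    by (simp add: S_def[abs_def] field_simps)
  \<comment> \<open>With \<open>w = s * p * q\<close> inserted, both sides are rational in
    \<open>S t\<close>, the sine and the cosine, so clearing denominators proves this and the next
    identity.\<close>
  have x: "((\<lambda>t. p * cos (w * t) / S t) has_real_derivative
      - s * (q * sin (w * t) / S t) * (p\<^sup>2 + b * (p * cos (w * t) / S t)\<^sup>2)) (at t)"
    by (rule has_S derivative_eq_intros refl)+
       (use S[of t] in \<open>simp_all add: w_def field_simps power2_eq_square\<close>)
  have y: "((\<lambda>t. q * sin (w * t) / S t) has_real_derivative
      s * (p * cos (w * t) / S t) * (q\<^sup>2 - b * (q * sin (w * t) / S t)\<^sup>2)) (at t)"
    by (rule has_S derivative_eq_intros refl)+
       (use S[of t] in \<open>simp_all add: w_def field_simps power2_eq_square\<close>)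
  have "((\<lambda>t. vector [p * cos (w * t) / S t, q * sin (w * t) / S t] :: real^2)
      has_vector_derivative s *\<^sub>R rot_field a b d
        (vector [p * cos (w * t) / S t, q * sin (w * t) / S t])) (at t)"
    unfolding has_vector_derivative_def ad
    by (rule has_derivative_eq_rhs,
        rule vec2_has_derivative[OF x[unfolded has_field_derivative_def] y[unfolded has_field_derivative_def]])
       (simp add: fun_eq_iff vec_eq_iff forall_2 rot_field_def algebra_simps)
  moreover have "rot_orbit a b d c (w * t) = vector [p * cos (w * t) / S t, q * sin (w * t) / S t]" for t
    by (simp add: rot_orbit_def S_def D_def p_def q_def vec_eq_iff forall_2)
  moreover have "s * sqrt (a * d) = w"
    by (simp add: w_def p_def q_def real_sqrt_mult)
  ultimately show ?thesis
    by simp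
qed

lemma periodic_orbit_rot_orbit:
  assumes "a > 0" and "d > 0" and "c > 0" and "c + b > 0" and "s \<noteq> 0"
  shows "is_periodic_orbit (\<lambda>u. s *\<^sub>R rot_field a b d u) (range (rot_orbit a b d c))"
proof -
  let ?w = "s * sqrt (a * d)"
  let ?\<gamma> = "\<lambda>t. rot_orbit a b d c (?w * t)"
  have w: "?w \<noteq> 0"
    using assms by simp
  have sol: "is_solution (\<lambda>u. s *\<^sub>R rot_field a b d u) ?\<gamma>"
    unfolding is_solution_def using assms by (auto intro: rot_orbit_has_vector_derivative)
  have pos: "2 * pi / \<bar>?w\<bar> > 0"
    using w by simp
  have per: "?\<gamma> (t + 2 * pi / \<bar>?w\<bar>) = ?\<gamma> t" for t
  proof -
    \<comment> \<open>The sign of \<open>?w\<close> decides whether the angle makes its full turn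
      forwards or backwards.\<close>
    have "?w * (t + 2 * pi / \<bar>?w\<bar>) = ?w * t + 2 * pi \<or> ?w * (t + 2 * pi / \<bar>?w\<bar>) = ?w * t - 2 * pi"
      using w by (auto simp: abs_if field_simps)
    then show ?thesis
      by (auto simp: rot_orbit_def sin_diff cos_diff)
  qed
  have nonconst: "?\<gamma> (pi / ?w) \<noteq> ?\<gamma> 0"
  proof -
    \<comment> \<open>Half a turn moves the orbit to the opposite side of the second axis.\<close>
    have "?\<gamma> (pi / ?w) $ 1 < 0" "?\<gamma> 0 $ 1 > 0"
      using w assms by (auto simp: rot_orbit_def)
    then show ?thesis
      by fastforce
  qed
  have ran: "range (rot_orbit a b d c) = range ?\<gamma>"
  proof -
    have "rot_orbit a b d c \<theta> = ?\<gamma> (\<theta> / ?w)" for \<theta>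
      using w by simp
    then have "rot_orbit a b d c \<theta> \<in> range ?\<gamma>" for \<theta>
      by (rule range_eqI)
    then show ?thesis
      by auto
  qed
  show ?thesis
    unfolding is_periodic_orbit_def
    by (rule exI[of _ ?\<gamma>], rule exI[of _ "2 * pi / \<bar>?w\<bar>"])
       (intro conjI allI sol pos per ran exI[of _ "pi / ?w"] nonconst)
qed

text \<open>The polar angle of the scaled point is read off and the radius equation is solved for
  \<open>c\<close>. The two strict inequalities then become \<open>c + b > 0\<close> and
  \<open>c > 0\<close>.\<close>

lemma rot_orbit_through:
  assumes "a > 0" and "d > 0" and "u \<noteq> 0"
    and u1: "a + b * (u$1)\<^sup>2 > 0" and u2: "d - b * (u$2)\<^sup>2 > 0"
  obtains c where "c > 0" and "c + b > 0" and "u \<in> range (rot_orbit a b d c)"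
proof -
  define p where "p = u$1 / sqrt a"
  define q where "q = u$2 / sqrt d"
  have u_eq: "u$1 = sqrt a * p" "u$2 = sqrt d * q"
    using assms by (auto simp: p_def q_def)
  define r where "r = sqrt (p\<^sup>2 + q\<^sup>2)"
  have "p \<noteq> 0 \<or> q \<noteq> 0"
    using assms(3) u_eq by (auto simp: vec_eq_iff forall_2)
  then have r: "r > 0" "r\<^sup>2 = p\<^sup>2 + q\<^sup>2"
    by (auto simp: r_def sum_power2_gt_zero_iff)
  have "(p / r)\<^sup>2 + (q / r)\<^sup>2 = 1"
    using r(1) by (simp add: power_divide r(2)[symmetric] flip: add_divide_distrib)
  then obtain \<theta> where \<theta>: "p / r = cos \<theta>" "q / r = sin \<theta>"
    using sincos_total_2pi by metis
  \<comment> \<open>Solution of \<open>c + b * (sin \<theta>)^2 = 1 / r^2\<close> with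
    \<open>sin \<theta> = q / r\<close>.\<close>
  define c where "c = (1 - b * q\<^sup>2) / r\<^sup>2"
  have "a * (1 + b * p\<^sup>2) > 0" "d * (1 - b * q\<^sup>2) > 0"
    using u1 u2 assms by (simp_all add: u_eq power_mult_distrib algebra_simps)
  then have pos: "1 + b * p\<^sup>2 > 0" "1 - b * q\<^sup>2 > 0"
    using assms by (simp_all add: zero_less_mult_iff)
  have "c + b = (1 + b * p\<^sup>2) / r\<^sup>2"
  proof -
    have "c + b = (1 - b * q\<^sup>2 + b * r\<^sup>2) / r\<^sup>2"
      using r(1) by (simp add: c_def add_divide_distrib)
    then show ?thesis
      by (simp add: r(2) algebra_simps)
  qed
  with pos r(1) have c: "c > 0" "c + b > 0"
    by (simp_all add: c_def)
  have "c + b * (sin \<theta>)\<^sup>2 = 1 / r\<^sup>2"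
    using r(1) by (simp add: c_def power_divide field_simps flip: \<theta>)
  then have "sqrt (c + b * (sin \<theta>)\<^sup>2) = 1 / r"
    using r(1) by (simp add: real_sqrt_divide)
  then have "rot_orbit a b d c \<theta> = u"
    using r(1) by (simp add: rot_orbit_def vec_eq_iff forall_2 u_eq flip: \<theta>)
  then show thesis
    using c that by blast
qed

text \<open>Converse of \<open>rot_orbit_through\<close>: on the orbit the two brackets of the field
  are \<open>a * (c + b) / D\<close> and \<open>d * c / D\<close>, and the squared scaled radius is
  \<open>1 / D\<close>.\<close>

lemma rot_orbit_bounds:
  fixes a b c d \<theta> :: real
  assumes "a > 0" and "d > 0" and "c > 0" and "c + b > 0"
  defines "v \<equiv> rot_orbit a b d c \<theta>"
  shows "a + b * (v$1)\<^sup>2 > 0" and "d - b * (v$2)\<^sup>2 > 0" and "v \<noteq> 0"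
proof -
  define D where "D = c + b * (sin \<theta>)\<^sup>2"
  have D: "D > 0"
    unfolding D_def by (rule rot_radius_pos) fact+
  have v: "(v$1)\<^sup>2 = a * (cos \<theta>)\<^sup>2 / D" "(v$2)\<^sup>2 = d * (sin \<theta>)\<^sup>2 / D"
    using D assms(1,2) by (simp_all add: v_def rot_orbit_def power_mult_distrib power_divide D_def)
  have "a + b * (v$1)\<^sup>2 = a * (c + b) / D"
    using D unfolding v cos_squared_eq by (simp add: field_simps) (simp add: D_def algebra_simps)
  then show "a + b * (v$1)\<^sup>2 > 0"
    using D assms by simp
  have "d - b * (v$2)\<^sup>2 = d * c / D"
    using D unfolding v by (simp add: field_simps) (simp add: D_def algebra_simps)
  then show "d - b * (v$2)\<^sup>2 > 0"
    using D assms by simp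
  have "(v$1)\<^sup>2 / a + (v$2)\<^sup>2 / d = 1 / D"
    using D assms(1,2) unfolding v by (simp flip: add_divide_distrib)
  then show "v \<noteq> 0"
    using D by auto
qed

lemma rot_field_center:
  assumes "a > 0" and "d > 0" and "s \<noteq> 0"
  shows "is_center (\<lambda>u. s *\<^sub>R rot_field a b d u) 0"
proof -
  \<comment> \<open>Where both brackets of the field are positive; apart from the origin this region
    is exactly a union of the explicit orbits.\<close>
  let ?N = "{u :: real^2. a + b * (u$1)\<^sup>2 > 0 \<and> d - b * (u$2)\<^sup>2 > 0}"
  have "open ?N"
    by (intro open_Collect_conj open_Collect_less continuous_intros)
  moreover have "0 \<in> ?N"
    using assms by simp
  moreover have "\<exists>X. is_periodic_orbit (\<lambda>u. s *\<^sub>R rot_field a b d u) X \<and> q \<in> X \<and> X \<subseteq> ?N - {0}"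
    if q: "q \<in> ?N - {0}" for q
  proof -
    obtain c where c: "c > 0" "c + b > 0" "q \<in> range (rot_orbit a b d c)"
      using rot_orbit_through[of a d q b] q assms by auto
    moreover have "range (rot_orbit a b d c) \<subseteq> ?N - {0}"
      using rot_orbit_bounds[OF assms(1,2) c(1,2)] by auto
    ultimately show ?thesis
      using periodic_orbit_rot_orbit[OF assms(1,2) c(1,2) assms(3)] by blast
  qed
  moreover have "rot_field a b d 0 = 0"
    by (simp add: rot_field_def vec_eq_iff forall_2)
  ultimately show ?thesis
    unfolding is_center_def by (intro conjI exI[of _ ?N]) auto
qed

section \<open>Linearization of the rotating field at the origin\<close>

lemma rot_field_derivative_0:
  "((\<lambda>u. s *\<^sub>R rot_field a b d u) has_derivative (\<lambda>h. vector [- s * a * h$2, s * d * h$1])) (at 0)"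
  unfolding rot_field_def
  by (rule has_derivative_eq_rhs, (rule derivative_intros vec_nth_has_derivative)+)
     (auto simp: fun_eq_iff vec_eq_iff forall_2)

lemma rot_field_not_saddle:
  assumes "a > 0" and "d > 0" and "s \<noteq> 0"
  shows "\<not> is_saddle (\<lambda>u. s *\<^sub>R rot_field a b d u) 0"
proof
  assume "is_saddle (\<lambda>u. s *\<^sub>R rot_field a b d u) 0"
  then obtain L l v where L: "((\<lambda>u. s *\<^sub>R rot_field a b d u) has_derivative L) (at 0)"
    and lv: "l > 0" "v \<noteq> 0" "L v = l *\<^sub>R v"
    unfolding is_saddle_def by blast
  have "L = (\<lambda>h. vector [- s * a * h$2, s * d * h$1])"
    using has_derivative_unique[OF L rot_field_derivative_0] .
  with lv have eq: "- s * a * v$2 = l * v$1" "s * d * v$1 = l * v$2"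
    by (auto simp: vec_eq_iff forall_2)
  \<comment> \<open>The linearization is antisymmetric for the definite form
    \<open>d * x^2 + a * y^2\<close>, so pairing an eigenvector \<open>v\<close> with
    \<open>L v\<close> gives zero.\<close>
  have "l * (d * (v$1)\<^sup>2 + a * (v$2)\<^sup>2) = d * v$1 * (l * v$1) + a * v$2 * (l * v$2)"
    by (simp add: algebra_simps power2_eq_square)
  also have "\<dots> = 0"
    unfolding eq[symmetric] by (simp add: algebra_simps)
  finally have "d * (v$1)\<^sup>2 + a * (v$2)\<^sup>2 = 0"
    using lv by simp
  then have "v$1 = 0 \<and> v$2 = 0"
    using assms by (simp add: add_nonneg_eq_0_iff)
  with lv show False
    by (simp add: vec_eq_iff forall_2)
qed

section \<open>The saddle field\<close>

definition hyp_field :: "real \<Rightarrow> real^2 \<Rightarrow> real^2" where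
  "hyp_field a u = vector [u$2 * (a + (u$1)\<^sup>2), u$1 * (1 + (u$2)\<^sup>2)]"

lemma hyp_field_derivative_0:
  "((\<lambda>u. s *\<^sub>R hyp_field a u) has_derivative (\<lambda>h. vector [s * a * h$2, s * h$1])) (at 0)"
  unfolding hyp_field_def
  by (rule has_derivative_eq_rhs, (rule derivative_intros vec_nth_has_derivative)+)
     (auto simp: fun_eq_iff vec_eq_iff forall_2)

lemma hyp_field_saddle:
  assumes "a > 0" and "s \<noteq> 0"
  shows "is_saddle (\<lambda>u. s *\<^sub>R hyp_field a u) 0"
proof -
  let ?L = "\<lambda>h :: real^2. vector [s * a * h$2, s * h$1] :: real^2"
  let ?v = "vector [sqrt a, 1] :: real^2" and ?w = "vector [- sqrt a, 1] :: real^2"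
  have "?L ?v = (s * sqrt a) *\<^sub>R ?v" "?L ?w = (- s * sqrt a) *\<^sub>R ?w"
    using assms by (auto simp: vec_eq_iff forall_2)
  moreover have "?v \<noteq> 0" "?w \<noteq> 0"
    by (auto simp: vec_eq_iff forall_2)
  \<comment> \<open>Time reversal only swaps the roles of the two eigenvectors.\<close>
  moreover have "s * sqrt a > 0 \<and> - s * sqrt a < 0 \<or> - s * sqrt a > 0 \<and> s * sqrt a < 0"
    using assms by (auto simp: zero_less_mult_iff mult_less_0_iff)
  ultimately have "\<exists>l v. l > 0 \<and> v \<noteq> 0 \<and> ?L v = l *\<^sub>R v"
    and "\<exists>m v. m < 0 \<and> v \<noteq> 0 \<and> ?L v = m *\<^sub>R v"
    by metis+
  moreover have "hyp_field a 0 = 0"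
    by (simp add: hyp_field_def vec_eq_iff forall_2)
  ultimately show ?thesis
    unfolding is_saddle_def using hyp_field_derivative_0[of s a]
    by (intro conjI exI[of _ ?L]) simp_all
qed

lemma hyp_field_no_periodic_orbit:
  assumes "a > 0" and "s \<noteq> 0" and X: "is_periodic_orbit (\<lambda>u. s *\<^sub>R hyp_field a u) X"
  shows "X = {0}"
proof -
  obtain \<gamma> T where sol: "is_solution (\<lambda>u. s *\<^sub>R hyp_field a u) \<gamma>"
    and T: "T > 0" "\<And>t. \<gamma> (t + T) = \<gamma> t" and X: "X = range \<gamma>"
    using X unfolding is_periodic_orbit_def by blast
  \<comment> \<open>The extra factor \<open>s\<close> turns the derivative into a multiple of
    \<open>s^2\<close>, so \<open>h\<close> is nondecreasing for either direction of time.\<close>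
  define h where "h t = s * (\<gamma> t $ 1 * \<gamma> t $ 2)" for t
  define h' where "h' t = s\<^sup>2 * ((\<gamma> t $ 2)\<^sup>2 * (a + (\<gamma> t $ 1)\<^sup>2) + (\<gamma> t $ 1)\<^sup>2 * (1 + (\<gamma> t $ 2)\<^sup>2))" for t
  have comp: "((\<lambda>t. \<gamma> t $ i) has_real_derivative s * hyp_field a (\<gamma> t) $ i) (at t)" for i t
  proof -
    have "(\<gamma> has_vector_derivative s *\<^sub>R hyp_field a (\<gamma> t)) (at t)"
      using sol by (simp add: is_solution_def)
    from bounded_linear.has_vector_derivative[OF bounded_linear_vec_nth this, of i] show ?thesis
      by (simp add: has_real_derivative_iff_has_vector_derivative)
  qed
  have h: "(h has_real_derivative h' t) (at t)" for t
    unfolding h_def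
    by (rule derivative_eq_intros comp refl)+
       (simp add: h'_def hyp_field_def algebra_simps power2_eq_square)
  have h'_nonneg: "h' t \<ge> 0" for t
    using assms by (simp add: h'_def)
  have mono: "h t \<le> h t'" if "t \<le> t'" for t t'
    using DERIV_nonneg_imp_nondecreasing[OF that] h h'_nonneg by blast
  have "\<gamma> t = 0" for t
  proof -
    have per: "h (t + T) = h t" "h (t - T) = h t"
      using T(2)[of t] T(2)[of "t - T"] by (simp_all add: h_def)
    \<comment> \<open>Monotonicity squeezes \<open>h y\<close> between values of \<open>h\<close>
      one period apart, which coincide.\<close>
    have const: "h t = h y" if "\<bar>t - y\<bar> < T" for y
    proof (cases "t \<le> y")
      case True
      then show ?thesis
        using mono[of t y] mono[of y "t + T"] per(1) that by linarith
    next
      case False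
      then show ?thesis
        using mono[of y t] mono[of "t - T" y] per(2) that by linarith
    qed
    have "h' t = 0"
      by (rule DERIV_local_const[OF h T(1)]) (use const in auto)
    then have "(\<gamma> t $ 2)\<^sup>2 * (a + (\<gamma> t $ 1)\<^sup>2) = 0 \<and> (\<gamma> t $ 1)\<^sup>2 * (1 + (\<gamma> t $ 2)\<^sup>2) = 0"
      using assms by (simp add: h'_def add_nonneg_eq_0_iff)
    moreover have "a + (\<gamma> t $ 1)\<^sup>2 > 0" "1 + (\<gamma> t $ 2)\<^sup>2 > 0"
      using assms by (auto intro: add_pos_nonneg)
    ultimately show ?thesis
      by (auto simp: vec_eq_iff forall_2)
  qed
  then show ?thesis
    using X by auto
qed

lemma hyp_field_not_center:
  assumes "a > 0" and "s \<noteq> 0"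
  shows "\<not> is_center (\<lambda>u. s *\<^sub>R hyp_field a u) 0"
proof
  assume "is_center (\<lambda>u. s *\<^sub>R hyp_field a u) 0"
  then obtain N where N: "open N" "(0 :: real^2) \<in> N"
    and per: "\<And>q. q \<in> N - {0} \<Longrightarrow>
      \<exists>X. is_periodic_orbit (\<lambda>u. s *\<^sub>R hyp_field a u) X \<and> q \<in> X \<and> X \<subseteq> N - {0}"
    unfolding is_center_def by blast
  \<comment> \<open>The plane has no isolated points, so \<open>N\<close> contains some
    \<open>q\<close> off the origin; the periodic orbit through it would have to be
    \<open>{0}\<close>.\<close>
  have "N \<noteq> {0}"
    using N not_open_singleton by metis
  then obtain q where "q \<in> N - {0}"
    using N by blast
  from per[OF this] show False
    using hyp_field_no_periodic_orbit[OF assms] by blast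
qed

section \<open>Equilibria of the system at infinity\<close>

text \<open>Transfers planar results to the sphere. The property is assumed settled in every chart,
  because a point may be tested in any chart containing it.\<close>

lemma at_infinity_in_chart_eq_axis_endpoints:
  assumes K: "K \<subseteq> {1, 2, 3}"
    and P: "\<And>i s p. i \<in> {1, 2, 3} \<Longrightarrow> s \<in> {1, -1} \<Longrightarrow>
      P (\<lambda>u. s *\<^sub>R field_at_infinity i F u) p \<longleftrightarrow> i \<in> K \<and> p = 0"
  shows "{r. at_infinity_in_chart P F r} = (\<Union>i\<in>K. axis_endpoints i)"
proof (intro set_eqI iffI)
  fix r assume "r \<in> {r. at_infinity_in_chart P F r}"
  then obtain i s where r: "norm r = 1" "r$4 = 0" and i: "i \<in> {1, 2, 3}" and s: "s * r$i > 0"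
    and "i \<in> K" "(vector [chart_coord i r $ 1, chart_coord i r $ 2] :: real^2) = 0"
    unfolding at_infinity_in_chart_def sphere_at_infinity_def using P by blast
  moreover have "r$i \<noteq> 0"
    using s by auto
  \<comment> \<open>At a chart origin the other two chart ratios vanish, and \<open>r$4 = 0\<close>
    at infinity.\<close>
  ultimately have "r = axis i (r$i)"
    by (auto simp: vec_eq_iff forall_2 forall_4 axis_def chart_coord_def)
  moreover from this r(1) have "\<bar>r$i\<bar> = 1"
    by (metis norm_axis_real)
  then have "r$i = 1 \<or> r$i = -1"
    by linarith
  moreover have "axis i (-1 :: real) = - axis i 1"
    by (simp add: vec_eq_iff axis_def)
  ultimately have "r \<in> axis_endpoints i"
    unfolding axis_endpoints_def by (metis insert_iff)
  with \<open>i \<in> K\<close> show "r \<in> (\<Union>i\<in>K. axis_endpoints i)"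
    by blast
next
  fix r assume "r \<in> (\<Union>i\<in>K. axis_endpoints i)"
  then obtain i where i: "i \<in> K" "r = axis i 1 \<or> r = - axis i 1"
    by (auto simp: axis_endpoints_def)
  then have i3: "i \<in> {1, 2, 3}"
    using K by blast
  have "norm r = 1"
    using i(2) by auto
  moreover have "r$4 = 0"
    using i(2) i3 by (auto simp: axis_def)
  moreover have "(vector [chart_coord i r $ 1, chart_coord i r $ 2] :: real^2) = 0"
    using i(2) i3 by (auto simp: vec_eq_iff forall_2 chart_coord_def axis_def)
  moreover have "\<exists>s\<in>{1, -1}. s * r$i > 0"
    using i by (auto simp: axis_def)
  ultimately show "r \<in> {r. at_infinity_in_chart P F r}"
    unfolding at_infinity_in_chart_def sphere_at_infinity_def
    using P i(1) i3 by (simp only: mem_Collect_eq) blast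
qed

lemma hyp_field_eq_0_iff:
  assumes "a > 0"
  shows "hyp_field a p = 0 \<longleftrightarrow> p = 0"
proof -
  have "a + (p$1)\<^sup>2 > 0" "1 + (p$2)\<^sup>2 > 0"
    using assms by (auto intro: add_pos_nonneg)
  then show ?thesis
    by (auto simp: hyp_field_def vec_eq_iff forall_2)
qed

text \<open>If both brackets vanished, \<open>b\<close> would be both negative and positive; if one
  coordinate vanishes, the bracket multiplying the other one is \<open>a\<close> or
  \<open>d\<close>.\<close>

lemma rot_field_eq_0_iff:
  assumes "a > 0" and "d > 0"
  shows "rot_field a b d p = 0 \<longleftrightarrow> p = 0"
proof
  assume "rot_field a b d p = 0"
  then have eq: "p$2 = 0 \<or> a + b * (p$1)\<^sup>2 = 0" "p$1 = 0 \<or> d - b * (p$2)\<^sup>2 = 0"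
    by (auto simp: rot_field_def vec_eq_iff forall_2)
  have "\<not> (a + b * (p$1)\<^sup>2 = 0 \<and> d - b * (p$2)\<^sup>2 = 0)"
  proof
    assume *: "a + b * (p$1)\<^sup>2 = 0 \<and> d - b * (p$2)\<^sup>2 = 0"
    then have "b * (p$1)\<^sup>2 < 0" "b * (p$2)\<^sup>2 > 0"
      using assms by linarith+
    then show False
      by (simp add: mult_less_0_iff zero_less_mult_iff)
  qed
  with eq assms show "p = 0"
    by (auto simp: vec_eq_iff forall_2)
qed (simp add: rot_field_def vec_eq_iff forall_2)

lemma system_at_infinity_fields:
  "field_at_infinity 1 (system_field A C \<sigma> Ra) = rot_field 1 A 1"
  "field_at_infinity 2 (system_field A C \<sigma> Ra) = hyp_field A"
  "field_at_infinity 3 (system_field A C \<sigma> Ra) = (\<lambda>u. - rot_field A (-1) 1 u)"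
  unfolding system_at_infinity_1 system_at_infinity_2 system_at_infinity_3
  by (auto simp: fun_eq_iff rot_field_def hyp_field_def vec_eq_iff forall_2)

lemma center_at_infinity_iff:
  assumes "A > 0" and "i \<in> {1, 2, 3}" and "s \<in> {1, -1}"
  shows "is_center (\<lambda>u. s *\<^sub>R field_at_infinity i (system_field A C \<sigma> Ra) u) p \<longleftrightarrow>
    i \<in> {1, 3} \<and> p = 0"
proof -
  \<comment> \<open>Centers are equilibria, so only the chart origins remain to be
    classified.\<close>
  have zero: "s *\<^sub>R field_at_infinity i (system_field A C \<sigma> Ra) p = 0 \<longleftrightarrow> p = 0"
    using assms by (auto simp: system_at_infinity_fields rot_field_eq_0_iff hyp_field_eq_0_iff)
  have "is_center (\<lambda>u. s *\<^sub>R field_at_infinity i (system_field A C \<sigma> Ra) u) 0 \<longleftrightarrow> i \<in> {1, 3}"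
    \<comment> \<open>The field of \<open>U_3\<close> is a negated rotating field, hence the factor
      \<open>-s\<close>.\<close>
    using assms rot_field_center[of 1 1 s A] rot_field_center[of A 1 "-s" "-1"]
      hyp_field_not_center[of A s]
    by (auto simp: system_at_infinity_fields)
  with zero show ?thesis
    unfolding is_center_def by blast
qed

lemma saddle_at_infinity_iff:
  assumes "A > 0" and "i \<in> {1, 2, 3}" and "s \<in> {1, -1}"
  shows "is_saddle (\<lambda>u. s *\<^sub>R field_at_infinity i (system_field A C \<sigma> Ra) u) p \<longleftrightarrow>
    i \<in> {2} \<and> p = 0"
proof -
  have zero: "s *\<^sub>R field_at_infinity i (system_field A C \<sigma> Ra) p = 0 \<longleftrightarrow> p = 0"
    using assms by (auto simp: system_at_infinity_fields rot_field_eq_0_iff hyp_field_eq_0_iff)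
  have "is_saddle (\<lambda>u. s *\<^sub>R field_at_infinity i (system_field A C \<sigma> Ra) u) 0 \<longleftrightarrow> i \<in> {2}"
    using assms rot_field_not_saddle[of 1 1 s A] rot_field_not_saddle[of A 1 "-s" "-1"]
      hyp_field_saddle[of A s]
    by (auto simp: system_at_infinity_fields)
  with zero show ?thesis
    unfolding is_saddle_def by blast
qed

section \<open>Counting the endpoints\<close>

lemma axis_endpoint_eq_iff:
  "axis i 1 = (axis j 1 :: real^'n) \<longleftrightarrow> i = j" "axis i 1 \<noteq> (- axis j 1 :: real^'n)"
  by (auto simp: vec_eq_iff axis_def dest: spec[of _ i])

theorem theorem5p1:
  fixes A C \<sigma> Ra :: real
  assumes "A > 0" and "C > 0" and "\<sigma> > 0" and "Ra > 0"
  shows "centers_at_infinity (system_field A C \<sigma> Ra) = axis_endpoints 1 \<union> axis_endpoints 3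
       \<and> card (centers_at_infinity (system_field A C \<sigma> Ra)) = 4
       \<and> saddles_at_infinity (system_field A C \<sigma> Ra) = axis_endpoints 2
       \<and> card (saddles_at_infinity (system_field A C \<sigma> Ra)) = 2"
proof -
  have "centers_at_infinity (system_field A C \<sigma> Ra) = axis_endpoints 1 \<union> axis_endpoints 3"
    unfolding centers_at_infinity_def
    by (subst at_infinity_in_chart_eq_axis_endpoints[where K = "{1, 3}"])
       (use center_at_infinity_iff[OF assms(1)] in auto)
  moreover have "saddles_at_infinity (system_field A C \<sigma> Ra) = axis_endpoints 2"
    unfolding saddles_at_infinity_def
    by (subst at_infinity_in_chart_eq_axis_endpoints[where K = "{2}"])
       (use saddle_at_infinity_iff[OF assms(1)] in auto)
  moreover have "card (axis_endpoints 1 \<union> axis_endpoints 3) = 4" "card (axis_endpoints 2) = 2"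
    by (simp_all add: axis_endpoints_def card_insert_if axis_endpoint_eq_iff
          axis_endpoint_eq_iff(2)[symmetric])
  ultimately show ?thesis
    by simp
qed

end
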